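(* Let $\theta=[a_1,a_2,\dots]$ be an irrational with $a_1=a_2=a_3=1$, and let $f$ be a $\theta$-recurrent unimodal map with critical orbit $x_k=f^k(0)$. Then for $k>0$: (1) $x_{q_n}<0$ if $n\equiv0,1\pmod 4$ and $x_{q_n}>0$ otherwise; (2) if $k=\gamma q_n$ with $1<\gamma\le a_{n+1}$, then $x_{q_n}$ and $x_{k}$ have opposite signs; (3) if $k=\sum_{n\ge m}\gamma_nq_n$ is the Ostrowski representation of $k$ with $\gamma_m>0$ its lowest nonzero digit, then $x_k$ and $x_{\gamma_mq_m}$ have the same sign.
   Context: Let $I=[-1,1]$. A unimodal map is a continuous $f:I\to I$ strictly decreasing on $[-1,0]$, strictly increasing on $[0,1]$, $f(\pm1)=1$. For $x\neq0$ let $x'$ be the other point with $f(x')=f(x)$, $0':=0$, $I_x$ the closed interval with endpoints $x,x'$. $\theta=[a_1,a_2,\dots]=1/(a_1+1/(a_2+\cdots))$, $q_n$ the denominator of $[a_1,\dots,a_n]$ ($q_n=a_nq_{n-1}+q_{n-2}$; here $q_1=1,q_2=2,q_3=3$). For $x\in I$ with orbit $x_k=f^k(x)$, $k\ge1$ is a time of closest recurrence of $x$ to $I_x$ if $f(x_k)<f(x_j)$ for all $0<j<k$. For $\theta_N=[a_1,\dots,a_N]$, $x$ has $\theta_N$-recurrence if: (i) $x_k\notin I_x$ for $k=1,\dots,q_N$; (ii) the times of closest recurrence of $x$ to $I_x$ in $\{1,\dots,q_N\}$ are exactly $q_1,\dots,q_N$; (iii) for $m=0,\dots,a_N-1$,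 $x_{mq_{N-1}}$ has $[a_1,\dots,a_{N-1}]$-recurrence (void for $N=1$). $f$ is $\theta$-recurrent if $0$ has $[a_1,\dots,a_n]$-recurrence for every $n$. Ostrowski representation: every positive integer $k$ is uniquely $k=\sum_{n\ge1}\gamma_nq_n$ with integers $0\le\gamma_n\le a_{n+1}$, finitely many nonzero, and $\gamma_n=a_{n+1}\Rightarrow\gamma_{n-1}=0$. *)

theory Defs
  imports Complex_Main
begin

definition unimodal :: "(real \<Rightarrow> real) \<Rightarrow> bool" where
  "unimodal f \<longleftrightarrow>
     continuous_on {-1..1} f \<and> f ` {-1..1} \<subseteq> {-1..1} \<and>
     (\<forall>x y. -1 \<le> x \<longrightarrow> x < y \<longrightarrow> y \<le> 0 \<longrightarrow> f y < f x) \<and>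
     (\<forall>x y. 0 \<le> x \<longrightarrow> x < y \<longrightarrow> y \<le> 1 \<longrightarrow> f x < f y) \<and>
     f (-1) = 1 \<and> f 1 = 1"

definition partner :: "(real \<Rightarrow> real) \<Rightarrow> real \<Rightarrow> real" where
  "partner f x = (if x = 0 then 0 else (THE y. y \<in> {-1..1} \<and> y \<noteq> x \<and> f y = f x))"

definition Ix :: "(real \<Rightarrow> real) \<Rightarrow> real \<Rightarrow> real set" where
  "Ix f x = {min x (partner f x) .. max x (partner f x)}"

text \<open>Denominators of convergents of [a 1, a 2, ...]: q 0 = 1 (q_{-1} = 0 implicit),
  q 1 = a 1, q (n+2) = a (n+2) * q (n+1) + q n.\<close>
fun q :: "(nat \<Rightarrow> nat) \<Rightarrow> nat \<Rightarrow> nat" where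
  "q a 0 = 1"
| "q a (Suc 0) = a 1"
| "q a (Suc (Suc n)) = a (Suc (Suc n)) * q a (Suc n) + q a n"

definition closest_rec :: "(real \<Rightarrow> real) \<Rightarrow> real \<Rightarrow> nat \<Rightarrow> bool" where
  "closest_rec f x k \<longleftrightarrow> 1 \<le> k \<and> (\<forall>j. 0 < j \<and> j < k \<longrightarrow> f ((f ^^ k) x) < f ((f ^^ j) x))"

text \<open>x has [a 1,...,a N]-recurrence (N \<ge> 1); the N = 0 case is a vacuous base.\<close>
fun theta_rec :: "(real \<Rightarrow> real) \<Rightarrow> (nat \<Rightarrow> nat) \<Rightarrow> nat \<Rightarrow> real \<Rightarrow> bool" where
  "theta_rec f a 0 x = True"
| "theta_rec f a (Suc N) x =
     ((\<forall>k\<in>{1..q a (Suc N)}. (f ^^ k) x \<notin> Ix f x) \<and>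
      {k\<in>{1..q a (Suc N)}. closest_rec f x k} = q a ` {1..Suc N} \<and>
      (\<forall>m < a (Suc N). theta_rec f a N ((f ^^ (m * q a N)) x)))"

definition theta_recurrent :: "(real \<Rightarrow> real) \<Rightarrow> (nat \<Rightarrow> nat) \<Rightarrow> bool" where
  "theta_recurrent f a \<longleftrightarrow> (\<forall>n\<ge>1. theta_rec f a n 0)"

definition ostrowski :: "(nat \<Rightarrow> nat) \<Rightarrow> nat \<Rightarrow> (nat \<Rightarrow> nat) \<Rightarrow> bool" where
  "ostrowski a k gam \<longleftrightarrow>
     finite {n. gam n \<noteq> 0} \<and> gam 0 = 0 \<and>
     k = (\<Sum>n\<in>{n. gam n \<noteq> 0}. gam n * q a n) \<and>
     (\<forall>n\<ge>1. gam n \<le> a (Suc n)) \<and>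
     (\<forall>n\<ge>2. gam n = a (Suc n) \<longrightarrow> gam (n - 1) = 0)"

end

theory Submission
  imports Defs
begin

text \<open>
  Measure the distance of a point from the critical point by its value under \<open>f\<close>. The claimed
  signs amount to one explicit sequence, \<open>model_sign\<close>, in which the number of minus signs up to
  time \<open>q n\<close> is odd; by induction on \<open>N\<close>, every point \<open>y\<close> with
  \<open>[a 1, \<dots>, a N]\<close>-recurrence follows it up to time \<open>q (N - 1)\<close>, and so do the
  translates of \<open>y\<close> by multiples of \<open>q (N - 1)\<close> (the last one only up to time
  \<open>q (N - 2)\<close>).
  For the last translate this is a trapping argument: a deviation would keep the orbit so close
  to that of \<open>y\<close> that the closest return at time \<open>q N\<close> could not happen. Oddness then
  says that \<open>f\<close> iterated \<open>q (N - 2)\<close> times pushes points near the critical point towards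
  it from the model side, and a return at time \<open>q N\<close> that is closer than the one at time
  \<open>q (N - 2)\<close> forces the sign at time \<open>q (N - 2)\<close>. Multiples of \<open>q (N - 2)\<close>
  recede from the critical point and therefore have to jump across it.
\<close>

section \<open>The model sign sequence\<close>

definition ret_sign :: "nat \<Rightarrow> real" where
  "ret_sign n = (if n mod 4 \<in> {0, 1} then -1 else 1)"

definition level :: "(nat \<Rightarrow> nat) \<Rightarrow> nat \<Rightarrow> nat" where
  "level a k = (GREATEST n. q a n \<le> k)"

text \<open>The guard \<open>k \<le> r\<close> only serves termination: it never holds when \<open>q\<close> and \<open>k\<close> are positive.\<close>

function model_sign :: "(nat \<Rightarrow> nat) \<Rightarrow> nat \<Rightarrow> real" where
  "model_sign a k =
     (let n = level a k; r = k mod q a n in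
      if r = 0 \<or> k \<le> r then (if k = q a n then ret_sign n else - ret_sign n)
      else model_sign a r)"
  by auto
termination by (relation "measure snd") auto

declare model_sign.simps [simp del]

lemma ret_sign_cases: "ret_sign n = 1 \<or> ret_sign n = -1"
  by (simp add: ret_sign_def)

lemma ret_sign_Suc_Suc: "ret_sign (Suc (Suc n)) = - ret_sign n"
proof -
  have "Suc (Suc n) mod 4 \<in> {0, 1} \<longleftrightarrow> n mod 4 \<notin> {0, 1}"
    by (simp; presburger)
  then show ?thesis by (auto simp: ret_sign_def)
qed

lemma model_sign_cases: "model_sign a k = 1 \<or> model_sign a k = -1"
proof (induction a k rule: model_sign.induct)
  case (1 a k)
  then show ?case
    using ret_sign_cases[of "level a k"]
    by (subst (1 2) model_sign.simps) (auto simp: Let_def)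
qed

locale unimodal_digits =
  fixes f :: "real \<Rightarrow> real" and a :: "nat \<Rightarrow> nat"
  assumes digits_pos: "\<And>n. n \<ge> 1 \<Longrightarrow> a n \<ge> 1"
    and a1: "a 1 = 1" and a2: "a 2 = 1" and a3: "a 3 = 1"
    and unimodal: "unimodal f"
begin

section \<open>Growth of the denominators\<close>

lemma q_pos: "q a n > 0"
proof (induction n rule: less_induct)
  case (less n)
  show ?case
  proof (cases n)
    case (Suc m)
    then show ?thesis using a1 digits_pos less by (cases m) auto
  qed simp
qed

lemma q_1: "q a (Suc 0) = 1" and q_2: "q a 2 = 2" and q_3: "q a 3 = 3"
  using a1 a2 a3 by (auto simp: numeral_eq_Suc)

lemma q_less_Suc: "n \<ge> 1 \<Longrightarrow> q a n < q a (Suc n)"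
proof -
  assume "n \<ge> 1"
  then obtain m where m: "n = Suc m" by (cases n) auto
  have "1 * q a n \<le> a (Suc n) * q a n"
    using digits_pos[of "Suc n"] by (intro mult_le_mono1) simp
  moreover have "q a (Suc n) = a (Suc n) * q a n + q a m" using m by simp
  ultimately show ?thesis using q_pos[of m] by linarith
qed

lemma q_less: "1 \<le> m \<Longrightarrow> m < n \<Longrightarrow> q a m < q a n"
proof (induction n)
  case (Suc n)
  then show ?case using q_less_Suc[of n] by (cases "m = n") auto
qed simp

lemma q_mono: "m \<le> n \<Longrightarrow> q a m \<le> q a n"
proof (cases "m = n")
  case False
  assume "m \<le> n"
  show ?thesis
  proof (cases "m = 0")
    case True
    then show ?thesis using q_pos[of n] by simp
  next
    case m0: False
    then show ?thesis using q_less[of m n] \<open>m \<le> n\<close> False by simp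
  qed
qed simp

lemma q_ge: "n \<le> q a n"
proof (induction n)
  case (Suc n)
  then show ?case using q_less_Suc[of n] q_1 by (cases n) auto
qed simp

section \<open>Model signs under greedy division\<close>

lemma level_eq:
  assumes "n \<ge> 1" "q a n \<le> k" "k < q a (Suc n)"
  shows "level a k = n"
  unfolding level_def
proof (rule Greatest_equality)
  fix m assume "q a m \<le> k"
  then show "m \<le> n" using q_mono[of "Suc n" m] assms(3) by (meson leI le_less_trans not_less_eq_eq not_le)
qed (use assms in auto)

text \<open>Dividing by the largest available denominator strips the leading digit. Iterated, this
  leaves only the lowest nonzero digit, whose sign is flipped once the digit exceeds 1.\<close>

lemma model_sign_eq:
  assumes "n \<ge> 1" "g \<ge> 1" "r < q a n" "g * q a n + r < q a (Suc n)"
  shows "model_sign a (g * q a n + r) =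
    (if r = 0 then if g = 1 then ret_sign n else - ret_sign n else model_sign a r)"
proof -
  have g: "q a n \<le> g * q a n" using assms(2) by simp
  have l: "level a (g * q a n + r) = n"
    using assms(1,4) trans_le_add1[OF g] by (intro level_eq)
  have "\<not> g * q a n + r \<le> r" using g q_pos[of n] by linarith
  moreover have "(g * q a n + r) mod q a n = r" using assms(3) by simp
  moreover have "g * q a n = q a n \<longleftrightarrow> g = 1" using q_pos[of n] by simp
  ultimately show ?thesis
    by (subst model_sign.simps) (auto simp: l Let_def)
qed

lemma q_Suc: "n \<ge> 1 \<Longrightarrow> q a (Suc n) = a (Suc n) * q a n + q a (n - 1)"
  by (cases n) auto

lemma model_sign_rest:
  assumes "n \<ge> 1" "0 < r" "r < q a n" "g * q a n + r < q a (Suc n)"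
  shows "model_sign a (g * q a n + r) = model_sign a r"
  using model_sign_eq[OF assms(1) _ assms(3,4)] assms(2) by (cases g) auto

lemma model_sign_q: "model_sign a (q a n) = ret_sign n"
proof (cases n)
  case 0
  \<comment> \<open>Since \<open>q a 0 = q a 1\<close>, \<open>level\<close> picks the index 1 here;
    this is harmless because \<open>ret_sign 0 = ret_sign 1\<close>.\<close>
  have "model_sign a (1 * q a 1 + 0) = ret_sign 1"
    using q_1 q_2 by (subst model_sign_eq) (auto simp: numeral_eq_Suc)
  then show ?thesis using 0 q_1 by (simp add: ret_sign_def)
next
  case (Suc m)
  then show ?thesis
    using model_sign_eq[of n 1 0] q_pos[of n] q_less_Suc[of n] by simp
qed

lemma mult_q_less: "n \<ge> 1 \<Longrightarrow> g \<le> a (Suc n) \<Longrightarrow> g * q a n < q a (Suc n)"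
  using q_Suc[of n] q_pos[of "n - 1"] mult_le_mono1[of g "a (Suc n)" "q a n"] by linarith

lemma model_sign_mult_q:
  assumes "n \<ge> 1" "2 \<le> g" "g \<le> a (Suc n)"
  shows "model_sign a (g * q a n) = - ret_sign n"
  using model_sign_eq[of n g 0] assms q_pos[of n] mult_q_less[of n g] by simp

section \<open>Parity of the number of minus signs\<close>

definition parity :: "nat \<Rightarrow> real" where
  "parity k = (\<Prod>i\<in>{1..k}. model_sign a i)"

lemma parity_0 [simp]: "parity 0 = 1"
  by (simp add: parity_def)

lemma parity_Suc [simp]: "parity (Suc k) = parity k * model_sign a (Suc k)"
  by (simp add: parity_def)

lemma parity_cases: "parity k = 1 \<or> parity k = -1"
proof (induction k)
  case (Suc k)
  then show ?case using model_sign_cases[of a "Suc k"] by auto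
qed simp

lemma parity_add:
  assumes "n \<ge> 1" "r < q a n" "g * q a n + r < q a (Suc n)"
  shows "parity (g * q a n + r) = parity (g * q a n) * parity r"
  using assms(2,3)
proof (induction r)
  case (Suc r)
  then have "parity (g * q a n + r) = parity (g * q a n) * parity r" by simp
  moreover have "model_sign a (Suc (g * q a n + r)) = model_sign a (Suc r)"
    using model_sign_rest[of n "Suc r" g] assms(1) Suc.prems by simp
  ultimately show ?case by simp
qed simp

lemma parity_pred:
  assumes "d > 0" shows "parity (d - 1) = parity d * model_sign a d"
proof -
  obtain e where e: "d = Suc e" using assms by (cases d) auto
  show ?thesis using model_sign_cases[of a d] unfolding e by auto
qed

text \<open>A later block of length \<open>q a n\<close> repeats the signs of the first one except
  at its end, where the sign is flipped. The first block is odd, so every later one is even and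
  leaves the parity unchanged.\<close>

lemma parity_mult_q:
  assumes "n \<ge> 1" "parity (q a n) = -1" "1 \<le> g" "g \<le> a (Suc n)"
  shows "parity (g * q a n) = -1"
  using assms(3,4)
proof (induction g)
  case (Suc g)
  show ?case
  proof (cases "g = 0")
    case True
    then show ?thesis using assms(2) by simp
  next
    case False
    have lt: "Suc g * q a n < q a (Suc n)" using Suc.prems assms(1) mult_q_less by blast
    obtain d where d: "q a n = Suc d" using q_pos[of n] by (cases "q a n") auto
    have "parity (g * q a n + d) = parity (g * q a n) * parity d"
      using lt d assms(1) by (intro parity_add) auto
    moreover have "parity d = - ret_sign n"
      using parity_pred[of "q a n"] d assms(2) model_sign_q[of n] by (simp del: parity_Suc)
    moreover have "model_sign a (Suc g * q a n) = - ret_sign n"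
      using Suc.prems False assms(1) by (intro model_sign_mult_q) auto
    moreover have "parity (Suc g * q a n) = parity (g * q a n + d) * model_sign a (Suc g * q a n)"
      using parity_Suc[of "g * q a n + d"] d by (simp add: algebra_simps)
    moreover have "parity (g * q a n) = -1" using Suc False by simp
    ultimately show ?thesis using ret_sign_cases[of n] by auto
  qed
qed simp

text \<open>Up to \<open>q a n\<close> there are \<open>a n\<close> blocks of length
  \<open>q a (n - 1)\<close>, odd in total, and a partial block of length
  \<open>q a (n - 2)\<close>. The partial block differs from the initial stretch of that length, odd
  by induction, only in its last sign, because \<open>ret_sign n = - ret_sign (n - 2)\<close>; hence
  it is even.\<close>

lemma parity_q: "parity (q a n) = -1"
proof (induction n rule: less_induct)
  case (less n)
  show ?case
  proof (cases "n \<le> 1")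
    case True
    then have "q a n = 1" using q_1 by (cases n) auto
    moreover have "model_sign a 1 = -1"
      using model_sign_q[of 0] by (simp add: ret_sign_def)
    ultimately show ?thesis by (simp add: parity_def)
  next
    case False
    then obtain p where p: "n = Suc (Suc p)"
      by (metis One_nat_def Suc_leI le0 not_less_eq_eq old.nat.exhaust)
    define g where "g = a n"
    obtain d where d: "q a p = Suc d" using q_pos[of p] by (cases "q a p") auto
    have qn: "q a n = Suc (g * q a (Suc p) + d)" using p d g_def by simp
    have "parity (g * q a (Suc p) + d) = parity (g * q a (Suc p)) * parity d"
      using qn p d q_mono[of p "Suc p"] by (intro parity_add) auto
    moreover have "parity (g * q a (Suc p)) = -1"
      using less p g_def digits_pos[of n] by (intro parity_mult_q) auto
    moreover have "parity d = - ret_sign p"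
      using parity_pred[of "q a p"] d less[of p] p model_sign_q[of p] by (simp del: parity_Suc)
    moreover have "model_sign a (q a n) = - ret_sign p"
      using model_sign_q[of n] p ret_sign_Suc_Suc by simp
    ultimately show ?thesis unfolding qn using qn ret_sign_cases[of p] by auto
  qed
qed

lemma parity_pred_q: "parity (q a n - 1) = - ret_sign n"
  using parity_pred[of "q a n"] q_pos[of n] parity_q[of n] model_sign_q[of n] by simp

section \<open>Unimodal maps and distance from the critical point\<close>

lemma f_in: "x \<in> {-1..1} \<Longrightarrow> f x \<in> {-1..1}"
  using unimodal unfolding unimodal_def by blast

lemma orbit_in: "x \<in> {-1..1} \<Longrightarrow> (f ^^ k) x \<in> {-1..1}"
  by (induction k) (use f_in in auto)

lemma orbit_orbit: "(f ^^ k) ((f ^^ m) x) = (f ^^ (m + k)) x"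
  by (metis add.commute comp_apply funpow_add)

lemma f_dec: "-1 \<le> x \<Longrightarrow> x < y \<Longrightarrow> y \<le> 0 \<Longrightarrow> f y < f x"
  and f_inc: "0 \<le> x \<Longrightarrow> x < y \<Longrightarrow> y \<le> 1 \<Longrightarrow> f x < f y"
  and f_end: "f (-1) = 1" "f 1 = 1"
  using unimodal unfolding unimodal_def by auto

lemma f_0_le: "x \<in> {-1..1} \<Longrightarrow> f 0 \<le> f x"
  using f_dec[of x 0] f_inc[of 0 x] by (cases x "0::real" rule: linorder_cases) auto

lemma f_side_less:
  assumes "s = 1 \<or> s = -1" "x \<in> {-1..1}" "z \<in> {-1..1}" "0 \<le> s * x" "s * x < s * z"
  shows "f x < f z"
  using assms f_dec[of z x] f_inc[of x z] by auto

lemma f_side_le: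
  assumes "s = 1 \<or> s = -1" "x \<in> {-1..1}" "z \<in> {-1..1}" "0 \<le> s * x" "s * x \<le> s * z"
  shows "f x \<le> f z"
  using f_side_less[OF assms(1-4)] assms(1,5) by force

text \<open>Translates the condition on intervals into an inequality between values of
  \<open>f\<close>. Beyond \<open>y\<close> on its own side of 0, or beyond the partner on the other
  side, \<open>f\<close> is strictly larger.\<close>

lemma outside_Ix:
  assumes "x \<in> {-1..1}" "y \<in> {-1..1}" "x \<notin> Ix f y"
  shows "f y < f x"
proof (cases "y = 0")
  case True
  then have "x \<noteq> 0" using assms(3) by (simp add: Ix_def partner_def)
  then show ?thesis using True assms f_dec[of x 0] f_inc[of 0 x] by (cases "x < 0") auto
next
  case False
  define s :: real where "s = sgn y"
  have s: "s = 1 \<or> s = -1" "s * y > 0" using False by (auto simp: s_def sgn_if)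
  have cont: "continuous_on {-1..1} f" using unimodal by (simp add: unimodal_def)
  have le1: "f y \<le> 1" and ge0: "f 0 \<le> f y" using f_in f_0_le assms(2) by auto
  \<comment> \<open>The partner exists on the side opposite to \<open>y\<close> because
    \<open>f y\<close> lies between \<open>f 0\<close> and the value 1 taken at both ends.\<close>
  have "\<exists>z\<in>{-1..1}. s * z \<le> 0 \<and> f z = f y"
  proof (cases "s = 1")
    case True
    have "\<exists>z\<ge>-1. z \<le> 0 \<and> f z = f y"
      using le1 ge0 f_end by (intro IVT2') (auto intro: continuous_on_subset[OF cont])
    then show ?thesis using True by auto
  next
    case False
    have "\<exists>z\<ge>0. z \<le> 1 \<and> f z = f y"
      using le1 ge0 f_end by (intro IVT') (auto intro: continuous_on_subset[OF cont])
    then show ?thesis using False s by auto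
  qed
  then obtain z where z: "z \<in> {-1..1}" "s * z \<le> 0" "f z = f y" by blast
  have uniq: "w = z" if w: "w \<in> {-1..1}" "w \<noteq> y" "f w = f y" for w
  proof -
    have "\<not> s * w > 0"
      using f_side_less[OF s(1), of w y] f_side_less[OF s(1), of y w] w assms(2) s
      by (cases "w < y") auto
    then show ?thesis
      using f_side_less[of "-s" w z] f_side_less[of "-s" z w] w z s
      by (cases w z rule: linorder_cases) auto
  qed
  have "partner f y = z"
    unfolding partner_def using False z s uniq by (auto intro!: the_equality)
  then have "x < min y z \<or> max y z < x" using assms(3) by (auto simp: Ix_def)
  then have "s * y < s * x \<or> (-s) * z < (-s) * x"
    using s by auto
  then show ?thesis
    using f_side_less[OF s(1), of y x] f_side_less[of "-s" z x] s z assms by auto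
qed

section \<open>Inequalities drawn from recurrence\<close>

lemma theta_rec_shift:
  "theta_rec f a (Suc n) y \<Longrightarrow> m < a (Suc n) \<Longrightarrow> theta_rec f a n ((f ^^ (m * q a n)) y)"
  by simp

lemma theta_rec_Suc: "theta_rec f a (Suc n) y \<Longrightarrow> theta_rec f a n y"
  using theta_rec_shift[of n y 0] digits_pos[of "Suc n"] by (simp del: theta_rec.simps(2))

lemma theta_rec_outside:
  assumes "theta_rec f a n y" "n \<ge> 1" "y \<in> {-1..1}" "0 < k" "k \<le> q a n"
  shows "f y < f ((f ^^ k) y)"
proof -
  obtain m where "n = Suc m" using assms(2) by (cases n) auto
  then have "(f ^^ k) y \<notin> Ix f y" using assms by auto
  then show ?thesis using outside_Ix orbit_in assms(3) by blast
qed

lemma theta_rec_record: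
  assumes "theta_rec f a n y" "1 \<le> l" "l \<le> n" "0 < j" "j < q a l"
  shows "f ((f ^^ q a l) y) < f ((f ^^ j) y)"
proof -
  obtain m where m: "n = Suc m" using assms(2,3) by (cases n) auto
  have "{k\<in>{1..q a n}. closest_rec f y k} = q a ` {1..n}" using assms(1) unfolding m by simp
  then have "closest_rec f y (q a l)" using assms(2,3) by auto
  then show ?thesis using assms(4,5) by (auto simp: closest_rec_def)
qed

text \<open>A time of closest recurrence before \<open>q a (Suc l)\<close> is some
  \<open>q a i\<close> with \<open>i \<le> l\<close>, which is covered by
  \<open>theta_rec_record\<close>. Any other time is dominated by an earlier one, so strong
  induction applies.\<close>

lemma theta_rec_min:
  assumes "theta_rec f a n y" "1 \<le> l" "l < n" "0 < j" "j < q a (Suc l)"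
  shows "f ((f ^^ q a l) y) \<le> f ((f ^^ j) y)"
  using assms(4,5)
proof (induction j rule: less_induct)
  case (less j)
  obtain m where m: "n = Suc m" using assms(2,3) by (cases n) auto
  have eq: "{k\<in>{1..q a n}. closest_rec f y k} = q a ` {1..n}" using assms(1) unfolding m by simp
  show ?case
  proof (cases "closest_rec f y j")
    case True
    have "j \<in> {1..q a n}" using less.prems q_mono[of "Suc l" n] assms(3) by simp
    then have "j \<in> q a ` {1..n}" using True eq by blast
    then obtain i where i: "1 \<le> i" "j = q a i" by auto
    then have "i \<le> l" using less.prems q_mono[of "Suc l" i] by (meson not_less not_less_eq_eq)
    then consider "i = l" | "i < l" by linarith
    then show ?thesis
    proof cases
      case 2
      then show ?thesis
        using theta_rec_record[of n y l j] assms i q_less[of i l] less.prems by simp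
    qed (use i in simp)
  next
    case False
    then obtain i where "0 < i" "i < j" "f ((f ^^ i) y) \<le> f ((f ^^ j) y)"
      using less.prems by (auto simp: closest_rec_def not_less)
    then show ?thesis using less.IH[of i] less.prems by auto
  qed
qed

declare theta_rec.simps(2) [simp del]

section \<open>Orbits that follow the model signs\<close>

definition agrees :: "real \<Rightarrow> nat \<Rightarrow> bool" where
  "agrees x d \<longleftrightarrow> (\<forall>j. 0 < j \<and> j < d \<longrightarrow> sgn ((f ^^ j) x) = model_sign a j)"

lemma agrees_mono: "agrees x d \<Longrightarrow> e \<le> d \<Longrightarrow> agrees x e"
  by (auto simp: agrees_def)

lemma f_order_sgn:
  assumes "s = 1 \<or> s = -1" "e = 1 \<or> e = -1" "x \<in> {-1..1}" "z \<in> {-1..1}"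
    and "sgn x = s" "sgn z = s" "(0::real) < (z - x) * e"
  shows "0 < (f z - f x) * (e * s)"
proof -
  have "s * x > 0" "s * z > 0" using assms(1,5,6) by (auto simp: sgn_if split: if_splits)
  then show ?thesis
    using f_side_less[OF assms(1), of x z] f_side_less[OF assms(1), of z x] assms by auto
qed

text \<open>As long as two orbits follow the model signs, the branches of \<open>f\<close> they run through
  are the same, so their order is governed by the parity of the number of minus signs.\<close>

lemma orbit_less:
  assumes "x \<in> {-1..1}" "z \<in> {-1..1}" "agrees x (Suc r)" "agrees z (Suc r)" "f x < f z"
  shows "0 < ((f ^^ Suc r) z - (f ^^ Suc r) x) * parity r"
  using assms(3,4)
proof (induction r)
  case 0
  then show ?case using assms(5) by simp
next
  case (Suc r)
  then have "0 < ((f ^^ Suc r) z - (f ^^ Suc r) x) * parity r"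
    using agrees_mono[of _ "Suc (Suc r)" "Suc r"] by auto
  moreover have "sgn ((f ^^ Suc r) x) = model_sign a (Suc r)"
    "sgn ((f ^^ Suc r) z) = model_sign a (Suc r)"
    using Suc.prems unfolding agrees_def by blast+
  ultimately have "0 < (f ((f ^^ Suc r) z) - f ((f ^^ Suc r) x)) * (parity r * model_sign a (Suc r))"
    using orbit_in assms(1,2) model_sign_cases parity_cases by (intro f_order_sgn) blast+
  then show ?case by simp
qed

lemma orbit_le:
  assumes "x \<in> {-1..1}" "z \<in> {-1..1}" "agrees x (Suc r)" "agrees z (Suc r)" "f x \<le> f z"
  shows "0 \<le> ((f ^^ Suc r) z - (f ^^ Suc r) x) * parity r"
proof (cases "f x = f z")
  case True
  then have "(f ^^ Suc r) z = (f ^^ Suc r) x"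
    by (simp add: funpow_swap1)
  then show ?thesis by simp
next
  case False
  then show ?thesis using orbit_less[OF assms(1-4)] assms(5) by (simp add: less_imp_le)
qed

text \<open>By \<open>parity_pred_q\<close> the order is multiplied by \<open>- ret_sign n\<close>:
  of two points, the one farther from 0 lands farther away from the model side.\<close>

lemma orbit_less_q:
  assumes "x \<in> {-1..1}" "z \<in> {-1..1}" "agrees x (q a n)" "agrees z (q a n)" "f x < f z"
  shows "ret_sign n * (f ^^ q a n) z < ret_sign n * (f ^^ q a n) x"
proof -
  have "Suc (q a n - 1) = q a n" using q_pos[of n] by simp
  then have "0 < ((f ^^ q a n) z - (f ^^ q a n) x) * - ret_sign n"
    using orbit_less[of x z "q a n - 1"] assms parity_pred_q[of n] by simp
  then show ?thesis by (simp add: algebra_simps)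
qed

lemma orbit_le_q:
  assumes "x \<in> {-1..1}" "z \<in> {-1..1}" "agrees x (q a n)" "agrees z (q a n)" "f x \<le> f z"
  shows "ret_sign n * (f ^^ q a n) z \<le> ret_sign n * (f ^^ q a n) x"
proof -
  have "Suc (q a n - 1) = q a n" using q_pos[of n] by simp
  then have "0 \<le> ((f ^^ q a n) z - (f ^^ q a n) x) * - ret_sign n"
    using orbit_le[of x z "q a n - 1"] assms parity_pred_q[of n] by simp
  then show ?thesis by (simp add: algebra_simps)
qed

text \<open>Each step preserves or reverses order, so \<open>w\<close> stays between
  \<open>x\<close> and \<open>z\<close>. These two are on the same side of 0, hence \<open>w\<close>
  is there too, and no closer to 0 than the nearer of them. The last fact is what rules out an
  unexpectedly close return.\<close>

lemma sandwich:
  assumes "x \<in> {-1..1}" "w \<in> {-1..1}" "z \<in> {-1..1}" "agrees x d" "agrees z d"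
    and "f x \<le> f w" "f w \<le> f z" "0 < j" "j < d"
  shows "sgn ((f ^^ j) w) = model_sign a j \<and>
    (f ((f ^^ j) x) \<le> f ((f ^^ j) w) \<or> f ((f ^^ j) z) \<le> f ((f ^^ j) w))"
  using assms(8,9)
proof (induction j rule: less_induct)
  case (less j)
  obtain r where r: "j = Suc r" using less.prems by (cases j) auto
  have ag: "agrees x (Suc r)" "agrees w (Suc r)" "agrees z (Suc r)"
    using less r assms(4,5) by (auto simp: agrees_def)
  define X where "X = (f ^^ j) x"
  define W where "W = (f ^^ j) w"
  define Z where "Z = (f ^^ j) z"
  have sg: "sgn X = model_sign a j" "sgn Z = model_sign a j"
    using less.prems assms(4,5) by (auto simp: agrees_def X_def Z_def)
  have I: "X \<in> {-1..1}" "W \<in> {-1..1}" "Z \<in> {-1..1}"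
    unfolding X_def W_def Z_def using orbit_in assms(1-3) by blast+
  have "0 \<le> (W - X) * parity r" "0 \<le> (Z - W) * parity r"
    unfolding X_def W_def Z_def r using orbit_le assms(1-3,6,7) ag by blast+
  then have "X \<le> W \<and> W \<le> Z \<or> Z \<le> W \<and> W \<le> X" using parity_cases[of r] by auto
  moreover note model_sign_cases[of a j]
  ultimately have "sgn W = model_sign a j" "f X \<le> f W \<or> f Z \<le> f W"
    using sg I f_side_le[of 1 X W] f_side_le[of 1 Z W] f_side_le[of "-1" X W] f_side_le[of "-1" Z W]
    by (auto simp: sgn_if split: if_splits)
  then show ?case by (simp add: X_def W_def Z_def)
qed

lemma sandwich_agrees:
  assumes "x \<in> {-1..1}" "w \<in> {-1..1}" "z \<in> {-1..1}" "agrees x d" "agrees z d"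
    and "f x \<le> f w" "f w \<le> f z"
  shows "agrees w d"
  using sandwich[OF assms] by (auto simp: agrees_def)


lemma agrees_rest:
  assumes "n \<ge> 1" "agrees y (q a (Suc n))" "d \<le> q a n" "i * q a n + d \<le> q a (Suc n)"
  shows "agrees ((f ^^ (i * q a n)) y) d"
  unfolding agrees_def
proof (intro allI impI)
  fix j assume j: "0 < j \<and> j < d"
  then have "model_sign a (i * q a n + j) = model_sign a j"
    using assms by (intro model_sign_rest) auto
  then show "sgn ((f ^^ j) ((f ^^ (i * q a n)) y)) = model_sign a j"
    using assms(2,4) j unfolding agrees_def orbit_orbit by auto
qed

lemma sgn_orbit_q:
  assumes "n \<ge> 1" "agrees y (q a (Suc n))"
  shows "sgn ((f ^^ q a n) y) = ret_sign n"
  using assms q_pos[of n] q_less_Suc[of n] model_sign_q[of n] unfolding agrees_def by metis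

lemma ret_sign_mult_pos: "sgn x = ret_sign n \<Longrightarrow> 0 < ret_sign n * x"
  using ret_sign_cases[of n] by (force simp: sgn_1_pos sgn_1_neg)

lemma sgn_eq_ret_sign: "0 < ret_sign n * x \<Longrightarrow> sgn x = ret_sign n"
  using ret_sign_cases[of n] by (auto simp: sgn_if split: if_splits)

lemma sgn_eq_uminus_ret_sign: "ret_sign n * x < 0 \<Longrightarrow> sgn x = - ret_sign n"
  using ret_sign_cases[of n] by (auto simp: sgn_if split: if_splits)

text \<open>The points where \<open>f\<close> is at most \<open>f y\<close> form an interval;
  \<open>ret_sign n\<close> merely fixes an orientation.\<close>

lemma side_le:
  assumes "x \<in> {-1..1}" "y \<in> {-1..1}" "z \<in> {-1..1}"
    and "ret_sign n * x \<le> ret_sign n * w" "ret_sign n * z \<le> ret_sign n * x"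
    and "w \<in> {-1..1}" "f w \<le> f y" "f z \<le> f y"
  shows "f x \<le> f y"
proof (cases "0 \<le> ret_sign n * x")
  case True
  then show ?thesis using f_side_le[of "ret_sign n" x w] ret_sign_cases[of n] assms by auto
next
  case False
  then show ?thesis using f_side_le[of "- ret_sign n" x z] ret_sign_cases[of n] assms by auto
qed

section \<open>Trapping near the critical point\<close>

lemma mult_orbit_mono:
  assumes "\<And>i. i < A \<Longrightarrow> f ((f ^^ (i * b)) y) < f ((f ^^ (Suc i * b)) y)"
    and "i \<le> k" "k \<le> A"
  shows "f ((f ^^ (i * b)) y) \<le> f ((f ^^ (k * b)) y)"
  using assms(2,3)
proof (induction k)
  case (Suc k)
  then show ?case using assms(1)[of k] by (cases "i = Suc k") auto
qed simp

text \<open>After \<open>q a n\<close> steps \<open>w\<close> lies between multiple 1 and multiple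
  \<open>Suc i\<close> of the orbit of \<open>y\<close>. Both are at most as far from 0 as multiple
  \<open>Suc i\<close>, so the upper bound passes on with \<open>i\<close> raised by one.\<close>

lemma trap_step:
  assumes n: "n \<ge> 1" and y: "y \<in> {-1..1}" and w: "w \<in> {-1..1}"
    and ag: "agrees y (q a (Suc n))"
    and mono: "\<And>i. i < a (Suc n) \<Longrightarrow> f ((f ^^ (i * q a n)) y) < f ((f ^^ (Suc i * q a n)) y)"
    and i: "i < a (Suc n)" and "f y \<le> f w" "f w \<le> f ((f ^^ (i * q a n)) y)"
  shows "agrees w (q a n)"
    and "ret_sign n * (f ^^ q a n) w \<le> ret_sign n * (f ^^ q a n) y"
    and "f ((f ^^ q a n) w) \<le> f ((f ^^ (Suc i * q a n)) y)"
proof -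
  let ?z = "(f ^^ (i * q a n)) y"
  have z: "?z \<in> {-1..1}" using y orbit_in by blast
  have le: "i * q a n + q a n \<le> q a (Suc n)"
    using mult_q_less[of n "Suc i"] n i by simp
  have agz: "agrees ?z (q a n)" using agrees_rest[OF n ag _ le] by simp
  have agy: "agrees y (q a n)" using ag agrees_mono q_mono[of n "Suc n"] by simp
  show agw: "agrees w (q a n)" using sandwich_agrees y w z agy agz assms(7,8) by blast
  show le1: "ret_sign n * (f ^^ q a n) w \<le> ret_sign n * (f ^^ q a n) y"
    using orbit_le_q y w agy agw assms(7) by blast
  have le2: "ret_sign n * (f ^^ q a n) ?z \<le> ret_sign n * (f ^^ q a n) w"
    using orbit_le_q z w agz agw assms(8) by blast
  have zeq: "(f ^^ q a n) ?z = (f ^^ (Suc i * q a n)) y"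
    unfolding orbit_orbit by (simp add: add.commute)
  have "f ((f ^^ q a n) y) \<le> f ((f ^^ (Suc i * q a n)) y)"
    using mult_orbit_mono[of "a (Suc n)" "q a n" y 1 "Suc i"] mono i by simp
  then show "f ((f ^^ q a n) w) \<le> f ((f ^^ (Suc i * q a n)) y)"
    using side_le[of "(f ^^ q a n) w" "(f ^^ (Suc i * q a n)) y" "(f ^^ q a n) ?z" n "(f ^^ q a n) y"]
      le1 le2 orbit_in y w z unfolding zeq by blast
qed

text \<open>Iterates \<open>trap_step\<close>. That lemma reproduces only the upper bound, so the
  lower bound is demanded afresh at each multiple by \<open>out\<close>.\<close>

lemma trap:
  assumes n: "n \<ge> 1" and y: "y \<in> {-1..1}" and w: "w \<in> {-1..1}"
    and ag: "agrees y (q a (Suc n))"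
    and mono: "\<And>i. i < a (Suc n) \<Longrightarrow> f ((f ^^ (i * q a n)) y) < f ((f ^^ (Suc i * q a n)) y)"
    and i: "i + K \<le> a (Suc n)" and fw: "f w \<le> f ((f ^^ (i * q a n)) y)"
    and out: "\<And>k. k < K \<Longrightarrow> f y \<le> f ((f ^^ (k * q a n)) w)"
  shows "f ((f ^^ (K * q a n)) w) \<le> f ((f ^^ ((i + K) * q a n)) y)"
  using i out
proof (induction K)
  case 0
  then show ?case using fw by simp
next
  case (Suc K)
  let ?w = "(f ^^ (K * q a n)) w"
  have "f ((f ^^ q a n) ?w) \<le> f ((f ^^ (Suc (i + K) * q a n)) y)"
    using Suc w orbit_in mono by (intro trap_step(3)[OF n y _ ag]) auto
  moreover have "(f ^^ q a n) ?w = (f ^^ (Suc K * q a n)) w"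
    unfolding orbit_orbit by (simp add: add.commute)
  ultimately show ?case by simp
qed

lemma nonzero_if_above: "x \<in> {-1..1} \<Longrightarrow> f x < f z \<Longrightarrow> z \<noteq> 0"
  using f_0_le by force

text \<open>Here \<open>b = q (p+1)\<close>, and the orbit of \<open>u\<close> is watched at the
  multiples of \<open>b\<close>. A wrong sign at some multiple keeps \<open>u\<close> trapped so close to the critical
  point that at time \<open>A b\<close> it still shadows \<open>y\<close> for \<open>b\<close> further steps; the next closest
  return, only \<open>q p < b\<close> steps later, is then impossible.\<close>

lemma trapped_agrees:
  fixes p :: nat and y v u t :: real
  defines "b \<equiv> q a (Suc p)" and "A \<equiv> a (Suc (Suc p))" and "c \<equiv> q a p"
  assumes p: "p \<ge> 1"
    and I: "y \<in> {-1..1}" "v \<in> {-1..1}" "u \<in> {-1..1}" "t \<in> {-1..1}"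
    and ag: "agrees y (q a (Suc (Suc p)))" "agrees v (q a (Suc (Suc p)))" "agrees t b"
    and tb: "(f ^^ b) t = u"
    and ord: "f y \<le> f v" "f u < f t" "f t < f ((f ^^ b) v)"
    and mono: "\<And>i. i < A \<Longrightarrow> f ((f ^^ (i * b)) y) < f ((f ^^ (Suc i * b)) y)"
    and out: "\<And>j. j \<le> A * b \<Longrightarrow> f y < f ((f ^^ j) u)"
    and rec_t: "f ((f ^^ (A * b + c)) u) < f ((f ^^ c) t)"
    and rec_y: "\<And>j. 0 < j \<Longrightarrow> j < q a (Suc (Suc p)) \<Longrightarrow>
                  f ((f ^^ (A * b + c)) u) < f ((f ^^ j) y)"
  shows "agrees u (q a (Suc (Suc p)))"
proof -
  let ?s = "ret_sign (Suc p)"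
  have cb: "c < b" and c0: "0 < c" using q_less[of p "Suc p"] p q_pos by (auto simp: b_def c_def)
  have qpp: "q a (Suc (Suc p)) = A * b + c" by (simp add: A_def b_def c_def)
  have A1: "1 \<le> A" using digits_pos by (simp add: A_def)
  have p1: "Suc p \<ge> 1" by simp
  note s_cases = ret_sign_cases[of "Suc p"]
  have orb: "(f ^^ j) x \<in> {-1..1}" if "x \<in> {y, v, u, t}" for x j
    using that I orbit_in by blast
  have fyu: "f y < f u" using out[of 0] by simp
  have bq: "b \<le> q a (Suc (Suc p))" using q_mono[of "Suc p" "Suc (Suc p)"] by (simp add: b_def)
  have agy: "agrees y b" and agv: "agrees v b" using ag(1,2) bq agrees_mono by blast+
  have agu: "agrees u b"
    using sandwich_agrees[OF I(1,3,4) agy ag(3)] fyu ord by simp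
  \<comment> \<open>In distance \<open>u\<close> lies between \<open>y\<close> and \<open>t\<close>,
    so \<open>(f ^^ b) u\<close> is caught between \<open>(f ^^ b) y\<close> and
    \<open>(f ^^ b) t\<close>, and the latter is \<open>u\<close> itself.\<close>
  have ub_le: "?s * (f ^^ b) u \<le> ?s * (f ^^ b) y"
    using orbit_le_q[of y u "Suc p"] I agy agu fyu by (simp add: b_def)
  have ub_ge: "?s * u \<le> ?s * (f ^^ b) u"
    using orbit_le_q[of u t "Suc p"] I ag(3) agu ord tb by (simp add: b_def)
  have sy: "sgn ((f ^^ b) y) = ?s" "sgn ((f ^^ b) v) = ?s"
    unfolding b_def by (rule sgn_orbit_q; use ag in simp)+
  have "?s * (f ^^ b) v \<le> ?s * (f ^^ b) y"
    using orbit_le_q[of y v "Suc p"] I agy agv ord by (simp add: b_def)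
  then have fvy: "f ((f ^^ b) v) \<le> f ((f ^^ b) y)"
    using f_side_le[OF s_cases] orb ret_sign_mult_pos[OF sy(2)] by auto
  have fuy: "f u \<le> f ((f ^^ b) y)" using ord fvy by linarith
  have base: "f ((f ^^ b) u) \<le> f ((f ^^ b) y)"
    using side_le[OF _ _ _ ub_le ub_ge] orb I fuy by auto
  have step: "agrees w b" "?s * (f ^^ b) w \<le> ?s * (f ^^ b) y"
    if "w \<in> {-1..1}" "i < A" "f y \<le> f w" "f w \<le> f ((f ^^ (i * b)) y)" for w i
    using trap_step(1,2)[OF p1 I(1) that(1) ag(1), of i] mono that by (auto simp: A_def b_def)
  have trapped: "f ((f ^^ ((m + K) * b)) u) \<le> f ((f ^^ ((i + K) * b)) y)"
    if "i + K \<le> A" "m + K \<le> A" "f ((f ^^ (m * b)) u) \<le> f ((f ^^ (i * b)) y)" for i m K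
  proof -
    have "f ((f ^^ (K * b)) ((f ^^ (m * b)) u)) \<le> f ((f ^^ ((i + K) * b)) y)"
      unfolding b_def
    proof (rule trap[OF p1 I(1) _ ag(1)])
      fix k assume "k < K"
      then have "m * b + k * b \<le> A * b"
        unfolding add_mult_distrib[symmetric] using that(2) by (intro mult_le_mono1) simp
      then show "f y \<le> f ((f ^^ (k * q a (Suc p))) ((f ^^ (m * q a (Suc p))) u))"
        unfolding orbit_orbit using out[of "m * b + k * b"] by (simp add: b_def)
    qed (use that orb mono in \<open>auto simp: A_def b_def\<close>)
    then show ?thesis unfolding orbit_orbit by (simp add: add_mult_distrib)
  qed
  have upper: "f ((f ^^ (k * b)) u) \<le> f ((f ^^ (k * b)) y)" if "1 \<le> k" "k \<le> A" for k
    using trapped[of 1 "k - 1" 1] that base by simp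
  \<comment> \<open>Being one multiple ahead of \<open>y\<close> is fatal: at time
    \<open>A * b\<close> the orbit of \<open>u\<close> would be squeezed between \<open>y\<close>
    and multiple \<open>A - 1\<close> of \<open>y\<close>, both of which follow the model for
    \<open>b > c\<close> steps. After \<open>c\<close> more steps \<open>sandwich\<close>
    contradicts \<open>rec_y\<close>.\<close>
  have no_return: False
    if A2: "A \<ge> 2" and le: "f ((f ^^ (A * b)) u) \<le> f ((f ^^ ((A - 1) * b)) y)"
  proof -
    have Ab: "(A - 1) * b + b = A * b" using A1 by (simp add: algebra_simps)
    have "agrees ((f ^^ ((A - 1) * b)) y) b"
      using agrees_rest[OF p1 ag(1), of b "A - 1"] Ab qpp by (simp add: b_def)
    then have "f ((f ^^ c) y) \<le> f ((f ^^ c) ((f ^^ (A * b)) u)) \<or>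
      f ((f ^^ c) ((f ^^ ((A - 1) * b)) y)) \<le> f ((f ^^ c) ((f ^^ (A * b)) u))"
      using sandwich[OF _ _ _ agy _ _ le c0 cb] orb I out[of "A * b"] by auto
    moreover have "(A - 1) * b + c < q a (Suc (Suc p))" using Ab qpp cb by linarith
    moreover have "c < q a (Suc (Suc p))" using cb bq by linarith
    ultimately show False
      using rec_y[of c] rec_y[of "(A - 1) * b + c"] c0 unfolding orbit_orbit by auto
  qed
  have nz: "(f ^^ (k * b)) u \<noteq> 0" if "k \<le> A" for k
    using nonzero_if_above[OF I(1) out[of "k * b"]] that by simp
  have first: "0 < ?s * (f ^^ b) u"
  proof (rule ccontr)
    assume "\<not> ?thesis"
    then have neg: "?s * (f ^^ b) u < 0" using nz[of 1] A1 s_cases by auto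
    \<comment> \<open>On the wrong side \<open>(f ^^ b) u\<close> is no farther from 0 than
      \<open>u\<close>, so it too is sandwiched between \<open>y\<close> and
      \<open>t\<close>.\<close>
    have fub: "f ((f ^^ b) u) \<le> f u"
      using f_side_le[of "- ?s" "(f ^^ b) u" u] s_cases neg ub_ge orb I by auto
    have fyb: "f y \<le> f ((f ^^ b) u)" using out[of b] A1 by simp
    have fbt: "f ((f ^^ b) u) \<le> f t" using fub ord by simp
    show False
    proof (cases "A = 1")
      case True
      have "f ((f ^^ c) y) \<le> f ((f ^^ c) ((f ^^ b) u)) \<or>
        f ((f ^^ c) t) \<le> f ((f ^^ c) ((f ^^ b) u))"
        using sandwich[OF I(1) _ I(4) agy ag(3) fyb fbt c0 cb] orb by auto
      then show False
        using rec_t rec_y[of c] c0 cb bq True unfolding orbit_orbit by auto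
    next
      case False
      then have A2: "A \<ge> 2" using A1 by simp
      have ubI: "(f ^^ b) u \<in> {-1..1}" using orb by simp
      have agub: "agrees ((f ^^ b) u) b"
        using sandwich_agrees[OF I(1) ubI I(4) agy ag(3) fyb fbt] .
      have "?s * (f ^^ b) ((f ^^ b) u) \<le> ?s * (f ^^ b) y"
        using orbit_le_q[of y "(f ^^ b) u" "Suc p"] I ubI agy agub fyb by (simp add: b_def)
      moreover have "?s * u \<le> ?s * (f ^^ b) ((f ^^ b) u)"
        using orbit_le_q[of "(f ^^ b) u" t "Suc p"] I ubI ag(3) agub fbt tb by (simp add: b_def)
      ultimately have "f ((f ^^ b) ((f ^^ b) u)) \<le> f ((f ^^ b) y)"
        using side_le[of "(f ^^ b) ((f ^^ b) u)" "(f ^^ b) y" u "Suc p" "(f ^^ b) y"]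
          orb I fuy orbit_in[OF ubI] by auto
      \<comment> \<open>Multiple 2 of \<open>u\<close> is now as close as multiple 1 of
        \<open>y\<close>; trapping carries this lead of one up to \<open>A\<close>.\<close>
      then have "f ((f ^^ (2 * b)) u) \<le> f ((f ^^ (1 * b)) y)"
        unfolding orbit_orbit by (simp add: mult_2)
      then have "f ((f ^^ (A * b)) u) \<le> f ((f ^^ ((A - 1) * b)) y)"
        using trapped[of 1 "A - 2" 2] A2 by (simp add: Suc_diff_le numeral_2_eq_2 Suc_diff_Suc)
      then show False using no_return A2 by blast
    qed
  qed
  have later: "?s * (f ^^ (k * b)) u < 0" if k: "2 \<le> k" "k \<le> A" for k
  proof (rule ccontr)
    assume "\<not> ?thesis"
    then have pos: "0 \<le> ?s * (f ^^ (k * b)) u" by simp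
    obtain l where l: "k = Suc l" "1 \<le> l" using k by (cases k) auto
    have "?s * (f ^^ b) ((f ^^ (l * b)) u) \<le> ?s * (f ^^ b) y"
      using upper[of l] l k out[of "l * b"] orb by (intro step(2)[of _ l]) auto
    then have "?s * (f ^^ (k * b)) u \<le> ?s * (f ^^ b) y"
      unfolding orbit_orbit l(1) by (simp add: add.commute)
    \<comment> \<open>On the model side multiple \<open>k\<close> of \<open>u\<close> lies between 0
      and multiple 1 of \<open>y\<close>, a lead of \<open>k - 1 \<ge> 1\<close>.\<close>
    then have "f ((f ^^ (k * b)) u) \<le> f ((f ^^ (1 * b)) y)"
      using f_side_le[OF s_cases _ _ pos] orb by simp
    then have "f ((f ^^ (A * b)) u) \<le> f ((f ^^ ((1 + (A - k)) * b)) y)"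
      using trapped[of 1 "A - k" k] k by simp
    also have "\<dots> \<le> f ((f ^^ ((A - 1) * b)) y)"
      using mono k by (intro mult_orbit_mono[of A]) auto
    finally show False using no_return k by simp
  qed
  show ?thesis
    unfolding agrees_def
  proof (intro allI impI)
    fix j assume j: "0 < j \<and> j < q a (Suc (Suc p))"
    define i where "i = j div b"
    define r where "r = j mod b"
    have jr: "j = i * b + r" by (simp add: i_def r_def)
    have rb: "r < b" using cb by (simp add: r_def)
    have "i * b < Suc A * b" using j jr qpp cb by simp
    then have iA: "i \<le> A" unfolding mult_less_cancel2 by simp
    show "sgn ((f ^^ j) u) = model_sign a j"
    proof (cases "r = 0")
      case True
      then have i1: "1 \<le> i" using j jr by (cases i) auto
      show ?thesis
      proof (cases "i = 1")
        case one: True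
        then show ?thesis
          using first True jr sgn_eq_ret_sign model_sign_q[of "Suc p"] by (simp add: b_def)
      next
        case False
        then have "model_sign a (i * b) = - ?s"
          unfolding b_def using i1 iA by (intro model_sign_mult_q) (auto simp: A_def)
        moreover have "sgn ((f ^^ (i * b)) u) = - ?s"
          using False i1 iA later by (intro sgn_eq_uminus_ret_sign) auto
        ultimately show ?thesis using True jr by simp
      qed
    next
      case False
      have ms: "model_sign a j = model_sign a r"
        unfolding jr b_def using False rb j jr by (intro model_sign_rest) (auto simp: b_def)
      have "sgn ((f ^^ r) ((f ^^ (i * b)) u)) = model_sign a r"
      proof (cases "i = A")
        case True
        \<comment> \<open>Only \<open>c\<close> steps remain after \<open>A\<close> blocks, and
          multiple \<open>A\<close> of \<open>y\<close> is known to follow the model just that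
          long.\<close>
        then have rc: "r < c" using j jr qpp by simp
        have "agrees ((f ^^ (A * b)) y) c"
          using agrees_rest[OF p1 ag(1), of c A] cb qpp by (simp add: b_def)
        moreover have "agrees y c" using agy cb agrees_mono by simp
        moreover have "f y \<le> f ((f ^^ (A * b)) u)" using out[of "A * b"] by simp
        ultimately have "agrees ((f ^^ (A * b)) u) c"
          using sandwich_agrees[OF I(1) orb orb, of u y c "A * b" "A * b"] upper[OF A1] by simp
        then show ?thesis using True rc False by (simp add: agrees_def)
      next
        case nA: False
        have "agrees ((f ^^ (i * b)) u) b"
        proof (cases "i = 0")
          case True
          then show ?thesis using agu by simp
        next
          case i0: False
          then have "f ((f ^^ (i * b)) u) \<le> f ((f ^^ (i * b)) y)" using upper iA by simp
          moreover have "f y \<le> f ((f ^^ (i * b)) u)" using out[of "i * b"] iA by simp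
          ultimately show ?thesis using step(1)[OF orb, of u i] iA nA by simp
        qed
        then show ?thesis using rb False by (simp add: agrees_def)
      qed
      then show ?thesis using ms jr unfolding orbit_orbit by simp
    qed
  qed
qed

section \<open>Recurrent points follow the model\<close>

definition follows_model :: "nat \<Rightarrow> real \<Rightarrow> bool" where
  "follows_model n y \<longleftrightarrow>
     (\<forall>m<a n. agrees ((f ^^ (m * q a (n - 1))) y) (q a (n - 1))) \<and>
     agrees ((f ^^ (a n * q a (n - 1))) y) (q a (n - 2))"

lemma multiple_recedes:
  assumes "n \<ge> 1" "y \<in> {-1..1}" "theta_rec f a (Suc n) y" "i < a (Suc n)"
  shows "f ((f ^^ (i * q a n)) y) < f ((f ^^ (Suc i * q a n)) y)"
proof -
  have "f ((f ^^ (i * q a n)) y) < f ((f ^^ q a n) ((f ^^ (i * q a n)) y))"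
    using theta_rec_outside[OF theta_rec_shift[OF assms(3,4)] assms(1)] orbit_in assms(2) q_pos
    by blast
  then show ?thesis unfolding orbit_orbit by (simp add: add.commute)
qed

text \<open>A wrong sign at time 1 or 2 would put two successive orbit points on one branch of
  \<open>f\<close>, in the order that makes the later return the farther one, although times 2 and 3
  are closest returns.\<close>

lemma theta_rec_3_signs:
  assumes "v \<in> {-1..1}" "theta_rec f a 3 v"
  shows "f v < 0" "f (f v) > 0"
proof -
  note out = theta_rec_outside[OF assms(2) _ assms(1)]
  have I: "f v \<in> {-1..1}" "f (f v) \<in> {-1..1}" "f (f (f v)) \<in> {-1..1}"
    using f_in assms(1) by blast+
  have r: "f (f (f v)) < f (f v)"
    using theta_rec_record[OF assms(2), of 2 1] q_2 by (simp add: numeral_eq_Suc)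
  have r': "f (f (f (f v))) < f (f (f v))"
    using theta_rec_record[OF assms(2), of 3 2] q_3 by (simp add: numeral_eq_Suc)
  have "f v < f (f v)" using out[of 1] q_3 by simp
  then show "f v < 0" using r f_inc[of "f v" "f (f v)"] I by force
  have "f (f v) \<noteq> 0"
    using nonzero_if_above[OF assms(1)] out[of 2] q_3 by (auto simp: numeral_eq_Suc)
  moreover have "\<not> f (f v) < 0" using r r' f_dec[of "f (f (f v))" "f (f v)"] I by auto
  ultimately show "f (f v) > 0" by simp
qed

text \<open>Recurrence is inherited only by translates with index below \<open>a (Suc n)\<close>.
  The tail after the last multiple is therefore reached from \<open>v\<close>, the last recurrent
  translate.\<close>

lemma base_orbit:
  assumes "n \<ge> 1" "y \<in> {-1..1}" "theta_rec f a (Suc n) y"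
  defines "v \<equiv> (f ^^ ((a (Suc n) - 1) * q a n)) y"
  shows "v \<in> {-1..1}" "theta_rec f a n v" "f y \<le> f v"
    and "(f ^^ (q a n + k)) v = (f ^^ (a (Suc n) * q a n + k)) y"
proof -
  have an: "a (Suc n) - 1 < a (Suc n)" using digits_pos[of "Suc n"] by simp
  show "v \<in> {-1..1}" using orbit_in assms(2) by (simp add: v_def)
  show "theta_rec f a n v" using theta_rec_shift[OF assms(3) an] by (simp add: v_def)
  show "f y \<le> f v"
    using mult_orbit_mono[of "a (Suc n)" "q a n" y 0 "a (Suc n) - 1"] multiple_recedes[OF assms(1-3)]
    by (simp add: v_def)
  have "(a (Suc n) - 1) * q a n + q a n = a (Suc n) * q a n"
    using digits_pos[of "Suc n"] by (simp add: diff_mult_distrib)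
  then show "(f ^^ (q a n + k)) v = (f ^^ (a (Suc n) * q a n + k)) y"
    unfolding v_def orbit_orbit by (metis add.assoc)
qed

text \<open>Done by hand because \<open>trapped_agrees\<close> requires \<open>p \<ge> 1\<close>,
  that is \<open>n \<ge> 4\<close> in \<open>tail_agrees\<close>. As \<open>q a 2 = 2\<close>, only
  the sign at time 1 is at stake.\<close>

lemma tail_agrees_three:
  assumes y: "y \<in> {-1..1}" and rec: "theta_rec f a 4 y"
  shows "agrees ((f ^^ (a 4 * q a 3)) y) (q a 2)"
proof -
  have four: "Suc 3 = (4::nat)" by simp
  have rec': "theta_rec f a (Suc 3) y" using rec by simp
  define v where "v = (f ^^ ((a 4 - 1) * q a 3)) y"
  define u where "u = (f ^^ (a 4 * q a 3)) y"
  note base = base_orbit[OF _ y rec', folded v_def, unfolded four, folded v_def, simplified]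
  have v: "v \<in> {-1..1}" "theta_rec f a 3 v" "f y \<le> f v" using base by auto
  have uv: "u = f (f (f v))" using base(4)[of 0] q_3 by (simp add: u_def numeral_eq_Suc)
  have "theta_rec f a 3 y" using theta_rec_Suc[OF rec'] .
  note sy = theta_rec_3_signs[OF y this] and sv = theta_rec_3_signs[OF v(1,2)]
  have I: "f y \<in> {-1..1}" "f (f y) \<in> {-1..1}" "f (f (f y)) \<in> {-1..1}" "f v \<in> {-1..1}" "f (f v) \<in> {-1..1}"
    "u \<in> {-1..1}" "f u \<in> {-1..1}"
    unfolding uv using f_in y v(1) by blast+
  have "f u < 0"
  proof (rule ccontr)
    assume "\<not> ?thesis"
    then have pos: "0 \<le> f u" by simp
    have fu: "f u < u"
      using theta_rec_record[OF v(2), of 3 2] q_3 by (simp add: uv numeral_eq_Suc)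
    \<comment> \<open>The increasing branch then gives \<open>u < f (f y)\<close>, so
      \<open>f u\<close> lies between 0 and the third iterate of \<open>y\<close>: a return closer
      than \<open>q a 3\<close>, yet earlier than \<open>q a 4\<close>.\<close>
    have "u < f (f v)"
    proof (rule ccontr)
      assume "\<not> ?thesis"
      then have "f (f (f v)) \<le> f u"
        using f_side_le[of 1 "f (f v)" u] sv I by auto
      then show False using fu by (simp add: uv[symmetric])
    qed
    also have "\<dots> \<le> f (f y)"
      using f_side_le[of "-1" "f v" "f y"] sv v(3) I by auto
    finally have "f u < f (f (f y))" using f_inc[of u] fu pos I by auto
    then have "f (f u) < f (f (f (f y)))" using f_inc[of "f u"] pos I by auto
    moreover have "f ((f ^^ q a 3) y) \<le> f ((f ^^ (a 4 * q a 3 + 1)) y)"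
    proof (rule theta_rec_min[OF rec])
      have "q a (Suc 3) = a 4 * q a 3 + 2" using q_Suc[of 3] q_2 by simp
      then show "a 4 * q a 3 + 1 < q a (Suc 3)" by simp
    qed auto
    ultimately show False using q_3 by (simp add: u_def numeral_eq_Suc)
  qed
  moreover have "model_sign a 1 = -1" using model_sign_q[of 0] by (simp add: ret_sign_def)
  ultimately show ?thesis
    using q_2 by (auto simp: agrees_def u_def less_Suc_eq numeral_2_eq_2)
qed

lemma tail_agrees:
  assumes n: "n \<ge> 1" and y: "y \<in> {-1..1}" and rec: "theta_rec f a (Suc n) y"
    and IH: "\<And>z. z \<in> {-1..1} \<Longrightarrow> theta_rec f a n z \<Longrightarrow> follows_model n z"
  shows "agrees ((f ^^ (a (Suc n) * q a n)) y) (q a (n - 1))"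
proof -
  consider "n \<le> 2" | "n = 3" | "n \<ge> 4" by linarith
  then show ?thesis
  proof cases
    case 1
    then have "n = 1 \<or> n = 2" using n by auto
    then have "q a (n - 1) = 1" using q_1 by auto
    then show ?thesis by (simp add: agrees_def)
  next
    case 2
    then show ?thesis using tail_agrees_three[OF y] rec by (simp add: numeral_eq_Suc)
  next
    case 3
    then obtain p where p: "n = Suc (Suc (Suc p))" "p \<ge> 1"
      by (intro that[of "n - 3"]) auto
    let ?D = "q a (Suc (Suc p))" and ?b = "q a (Suc p)" and ?c = "q a p"
    define v where "v = (f ^^ ((a (Suc n) - 1) * q a n)) y"
    define u where "u = (f ^^ (a (Suc n) * q a n)) y"
    define t where "t = (f ^^ ?D) v"
    note base = base_orbit[OF n y rec, folded v_def]
    have v: "v \<in> {-1..1}" "theta_rec f a n v" "f y \<le> f v" using base by auto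
    have uv: "u = (f ^^ q a n) v" using base(4)[of 0] by (simp add: u_def)
    have I: "u \<in> {-1..1}" "t \<in> {-1..1}" using orbit_in v(1) by (auto simp: uv t_def)
    note fv = IH[OF v(1,2)] and fy = IH[OF y theta_rec_Suc[OF rec]]
    have an: "0 < a n" using digits_pos n by force
    have agv: "agrees v ?D" and agy: "agrees y ?D"
      using fv fy an p by (auto simp: follows_model_def)
    have vu: "f v < f u" using theta_rec_outside[OF v(2) n v(1)] q_pos by (simp add: uv)
    have ut: "f u < f t"
      unfolding uv t_def
      by (intro theta_rec_record[OF v(2)]) (simp_all add: p q_pos q_less del: q.simps)
    show ?thesis
    proof (cases "a n = 1")
      case False
      \<comment> \<open>Here \<open>t\<close> is translate 1 of \<open>v\<close> and follows the
        model up to the full \<open>?D\<close>, so sandwiching suffices.\<close>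
      then have "1 < a n" using an by simp
      then have "agrees t ?D" using fv p by (auto simp: follows_model_def t_def dest!: spec[of _ 1])
      then have "agrees u ?D"
        using sandwich_agrees[OF v(1) I agv] vu ut by simp
      then show ?thesis using p by (simp add: u_def)
    next
      case True
      \<comment> \<open>Now \<open>t\<close> begins the final, shorter block and is known to follow
        the model only up to \<open>?b\<close>; trapping has to cover the rest.\<close>
      have qn: "q a n = ?D + ?b" using True p by simp
      have qD: "?D = a (Suc (Suc p)) * ?b + ?c" by simp
      have qS: "q a (Suc n) = a (Suc n) * q a n + ?D" using p by simp
      have cb: "?c < ?b" using p q_less by simp
      have rec2: "theta_rec f a (Suc (Suc p)) y"
        using theta_rec_Suc[OF theta_rec_Suc[OF rec[unfolded p]]] .
      have uorb: "(f ^^ j) u = (f ^^ (a (Suc n) * q a n + j)) y" for j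
        unfolding u_def orbit_orbit ..
      have uD: "(f ^^ ?D) u = (f ^^ q a (Suc n)) y" unfolding uorb qS ..
      have rec_y: "f ((f ^^ ?D) u) < f ((f ^^ j) y)" if "0 < j" "j < q a (Suc n)" for j
        unfolding uD using theta_rec_record[OF rec _ _ that] by simp
      have D_le: "?D \<le> q a (Suc n)" using p q_mono by simp
      have "agrees u ?D"
      proof (rule trapped_agrees[OF p(2) y v(1) I agy agv, folded qD])
        show "agrees t ?b" using fv True p by (simp add: follows_model_def t_def)
        show "(f ^^ ?b) t = u" unfolding t_def orbit_orbit uv qn ..
        show "f y \<le> f v" "f u < f t" by fact+
        show "f t < f ((f ^^ ?b) v)"
          unfolding t_def
          by (intro theta_rec_record[OF v(2)]) (simp_all add: p q_pos q_less del: q.simps)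
        show "f ((f ^^ (i * ?b)) y) < f ((f ^^ (Suc i * ?b)) y)" if "i < a (Suc (Suc p))" for i
          using multiple_recedes[OF _ y rec2 that] by simp
        show "f y < f ((f ^^ j) u)" if "j \<le> a (Suc (Suc p)) * ?b" for j
        proof -
          have "a (Suc n) * q a n + j \<le> q a (Suc n)" using that qS qD by linarith
          moreover have "0 < a (Suc n) * q a n + j" using digits_pos[of "Suc n"] q_pos[of n] by simp
          ultimately show ?thesis
            unfolding uorb using theta_rec_outside[OF rec _ y] by simp
        qed
        have teq: "(f ^^ ?c) t = (f ^^ ((a (Suc n) - 1) * q a n + ?D + ?c)) y"
          unfolding t_def v_def orbit_orbit ..
        have "(a (Suc n) - 1) * q a n + q a n = a (Suc n) * q a n"
          using digits_pos[of "Suc n"] by (simp add: diff_mult_distrib)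
        then have "(a (Suc n) - 1) * q a n + ?D + ?c < q a (Suc n)"
          using qn qS cb by linarith
        then show "f ((f ^^ ?D) u) < f ((f ^^ ?c) t)"
          unfolding teq using rec_y q_pos by simp
        show "f ((f ^^ ?D) u) < f ((f ^^ j) y)" if "0 < j" "j < ?D" for j
          using rec_y[of j] that D_le by simp
      qed
      then show ?thesis using p by (simp add: u_def)
    qed
  qed
qed

text \<open>If translate \<open>m\<close> landed off the model side, the last one, starting farther
  from 0, would land no closer to 0. But it lands on the closest return at time
  \<open>q a (Suc n)\<close>.\<close>

lemma sgn_penultimate:
  assumes n: "n \<ge> 1" and y: "y \<in> {-1..1}" and rec: "theta_rec f a (Suc n) y"
    and m: "m < a (Suc n)"
    and agu: "agrees ((f ^^ (a (Suc n) * q a n)) y) (q a (n - 1))"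
    and agv: "agrees ((f ^^ (m * q a n)) y) (q a (n - 1))"
  shows "sgn ((f ^^ q a (n - 1)) ((f ^^ (m * q a n)) y)) = ret_sign (n - 1)"
proof (rule ccontr)
  let ?d = "q a (n - 1)" and ?s = "ret_sign (n - 1)"
  let ?v = "(f ^^ (m * q a n)) y" and ?u = "(f ^^ (a (Suc n) * q a n)) y"
  assume "\<not> ?thesis"
  then have neg: "?s * (f ^^ ?d) ?v \<le> 0"
    using sgn_eq_ret_sign[of "n - 1"] by force
  have I: "?v \<in> {-1..1}" "?u \<in> {-1..1}" "(f ^^ ?d) ?v \<in> {-1..1}" "(f ^^ ?d) ?u \<in> {-1..1}"
    using orbit_in y by blast+
  have "f ?v \<le> f ?u"
    using mult_orbit_mono[of "a (Suc n)" "q a n" y m] multiple_recedes[OF n y rec] m by simp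
  then have "?s * (f ^^ ?d) ?u \<le> ?s * (f ^^ ?d) ?v"
    using orbit_le_q I agu agv by blast
  then have "f ((f ^^ ?d) ?v) \<le> f ((f ^^ ?d) ?u)"
    using f_side_le[of "- ?s" "(f ^^ ?d) ?v" "(f ^^ ?d) ?u"] ret_sign_cases[of "n - 1"] neg I by auto
  moreover have "f ((f ^^ q a (Suc n)) y) < f ((f ^^ (m * q a n + ?d)) y)"
  proof (rule theta_rec_record[OF rec])
    have "m * q a n < a (Suc n) * q a n" using m q_pos[of n] by simp
    then show "m * q a n + ?d < q a (Suc n)" using q_Suc[OF n] by linarith
  qed (use q_pos in auto)
  ultimately show False unfolding orbit_orbit q_Suc[OF n] by simp
qed

text \<open>For \<open>n \<ge> 2\<close>, \<open>follows_model n v\<close> is silent exactly at the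
  multiples of \<open>q a (n - 1)\<close>. The first is supplied by the hypothesis
  \<open>sg\<close>; the others have to jump across 0.\<close>

lemma full_agrees:
  assumes v: "v \<in> {-1..1}" and rec: "theta_rec f a n v" and n: "n \<ge> 1"
    and fm: "follows_model n v" and sg: "sgn ((f ^^ q a (n - 1)) v) = ret_sign (n - 1)"
  shows "agrees v (q a n)"
proof (cases "n = 1")
  case True
  then show ?thesis using q_1 by (simp add: agrees_def)
next
  case False
  then obtain k where k: "n = Suc k" "k \<ge> 1" using n by (cases n) auto
  let ?D = "q a k"
  have agm: "agrees ((f ^^ (m * ?D)) v) ?D" if "m < a n" for m
    using fm that k by (simp add: follows_model_def)
  have agl: "agrees ((f ^^ (a n * ?D)) v) (q a (k - 1))"
    using fm k by (simp add: follows_model_def numeral_2_eq_2)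
  have qn: "q a n = a n * ?D + q a (k - 1)" using q_Suc k by simp
  have le: "q a (k - 1) \<le> ?D" using q_mono by simp
  have mono: "\<And>i. i < a n \<Longrightarrow> f ((f ^^ (i * ?D)) v) < f ((f ^^ (Suc i * ?D)) v)"
    using multiple_recedes[OF k(2) v] rec k by simp
  show ?thesis
    unfolding agrees_def
  proof (intro allI impI)
    fix j assume j: "0 < j \<and> j < q a n"
    define i where "i = j div ?D"
    define r where "r = j mod ?D"
    have jr: "j = i * ?D + r" unfolding i_def r_def by (rule div_mult_mod_eq[symmetric])
    have rD: "r < ?D" using q_pos by (simp add: r_def)
    show "sgn ((f ^^ j) v) = model_sign a j"
    proof (cases "r = 0")
      case False
      have "agrees ((f ^^ (i * ?D)) v) (Suc r)"
      proof (cases "i < a n")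
        case True
        then show ?thesis using agm agrees_mono rD by (meson Suc_leI)
      next
        case i: False
        then have ge: "a n * ?D \<le> i * ?D" by simp
        then have rk: "r < q a (k - 1)" using j jr qn by linarith
        have "i * ?D < Suc (a n) * ?D" using j jr qn le by simp
        then have "i = a n" using i unfolding mult_less_cancel2 by simp
        then show ?thesis using agl agrees_mono rk by (simp add: Suc_leI)
      qed
      then have "sgn ((f ^^ j) v) = model_sign a r"
        using False unfolding agrees_def orbit_orbit jr by blast
      moreover have "model_sign a j = model_sign a r"
        unfolding jr using False rD j jr k by (intro model_sign_rest) auto
      ultimately show ?thesis by simp
    next
      case True
      then have ji: "j = i * ?D" using jr by simp
      then have i1: "1 \<le> i" using j by (cases i) auto
      show ?thesis
      proof (cases "i = 1")
        case one: True
        then show ?thesis using sg ji k model_sign_q[of k] by simp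
      next
        case False
        then obtain l where l: "i = Suc l" "1 \<le> l" using i1 by (cases i) auto
        have "i * ?D < Suc (a n) * ?D" using j ji qn le by simp
        then have ia: "i \<le> a n" unfolding mult_less_cancel2 by simp
        let ?w = "(f ^^ (l * ?D)) v"
        have "agrees ?w ?D" "agrees v ?D" using agm[of l] agm[of 0] l ia by auto
        moreover have "f v < f ?w"
          using mono[of 0] mult_orbit_mono[of "a n" ?D v 1 l] mono l ia by force
        ultimately have "ret_sign k * (f ^^ ?D) ?w < ret_sign k * (f ^^ ?D) v"
          using orbit_less_q v orbit_in by blast
        moreover have wi: "(f ^^ ?D) ?w = (f ^^ (i * ?D)) v"
          unfolding orbit_orbit l by (simp add: add.commute)
        ultimately have less: "ret_sign k * (f ^^ (i * ?D)) v < ret_sign k * (f ^^ ?D) v" by simp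
        \<comment> \<open>On the model side, \<open>less\<close> would place multiple
          \<open>i\<close> strictly closer to 0 than multiple 1, but multiples recede.\<close>
        have "ret_sign k * (f ^^ (i * ?D)) v < 0"
        proof (rule ccontr)
          assume "\<not> ?thesis"
          then have "f ((f ^^ (i * ?D)) v) < f ((f ^^ ?D) v)"
            using f_side_less[OF ret_sign_cases[of k] _ _ _ less] orbit_in v by force
          moreover have "f ((f ^^ ?D) v) \<le> f ((f ^^ (i * ?D)) v)"
            using mult_orbit_mono[of "a n" ?D v 1 i] mono i1 ia by simp
          ultimately show False by simp
        qed
        then have "sgn ((f ^^ j) v) = - ret_sign k"
          using sgn_eq_uminus_ret_sign ji by simp
        moreover have "model_sign a j = - ret_sign k"
          unfolding ji using k ia False i1 by (intro model_sign_mult_q) auto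
        ultimately show ?thesis by simp
      qed
    qed
  qed
qed

lemma theta_rec_follows_model:
  "y \<in> {-1..1} \<Longrightarrow> n \<ge> 1 \<Longrightarrow> theta_rec f a n y \<Longrightarrow> follows_model n y"
proof (induction n arbitrary: y)
  case (Suc n)
  show ?case
  proof (cases "n = 0")
    case True
    \<comment> \<open>Both truncated differences are 0, and \<open>agrees\<close> up to
      \<open>q a 0 = 1\<close> concerns no time at all.\<close>
    then show ?thesis by (simp add: follows_model_def agrees_def)
  next
    case False
    then have n: "n \<ge> 1" by simp
    have IH: "follows_model n z" if "z \<in> {-1..1}" "theta_rec f a n z" for z
      using Suc.IH[OF that(1) n that(2)] .
    note y = Suc.prems(1) and rec = Suc.prems(3)
    have tail: "agrees ((f ^^ (a (Suc n) * q a n)) y) (q a (n - 1))"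
      using tail_agrees[OF n y rec IH] .
    moreover have "agrees ((f ^^ (m * q a n)) y) (q a n)" if m: "m < a (Suc n)" for m
    proof -
      let ?v = "(f ^^ (m * q a n)) y"
      have v: "?v \<in> {-1..1}" "theta_rec f a n ?v"
        using orbit_in y theta_rec_shift[OF rec m] by auto
      have "agrees ?v (q a (n - 1))"
        using IH[OF v] digits_pos[OF n] by (auto simp: follows_model_def dest!: spec[of _ 0])
      then show ?thesis
        using full_agrees[OF v n IH[OF v]] sgn_penultimate[OF n y rec m tail] by blast
    qed
    ultimately show ?thesis by (simp add: follows_model_def numeral_2_eq_2)
  qed
qed simp

lemma critical_orbit_sgn:
  assumes "theta_recurrent f a" "k > 0"
  shows "sgn ((f ^^ k) 0) = model_sign a k"
proof -
  \<comment> \<open>At level \<open>?n\<close> the agreement reaches \<open>q a (Suc k)\<close>,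
    which exceeds \<open>k\<close>.\<close>
  let ?n = "Suc (Suc k)"
  have "follows_model ?n 0"
    using assms(1) by (intro theta_rec_follows_model) (auto simp: theta_recurrent_def)
  then have "agrees 0 (q a (Suc k))"
    using digits_pos[of ?n] by (auto simp: follows_model_def dest!: spec[of _ 0])
  moreover have "k < q a (Suc k)" using q_ge[of "Suc k"] by simp
  ultimately show ?thesis using assms(2) by (simp add: agrees_def)
qed

section \<open>Ostrowski digits and model signs\<close>

lemma ostrowski_partial_less:
  assumes "ostrowski a k gam"
  shows "(\<Sum>n\<le>M. gam n * q a n) < q a (Suc M)"
proof (induction M rule: less_induct)
  case (less M)
  have g0: "gam 0 = 0" and gle: "\<And>n. n \<ge> 1 \<Longrightarrow> gam n \<le> a (Suc n)"
    and carry: "\<And>n. n \<ge> 2 \<Longrightarrow> gam n = a (Suc n) \<Longrightarrow> gam (n - 1) = 0"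
    using assms by (auto simp: ostrowski_def)
  show ?case
  proof (cases M)
    case 0
    then show ?thesis using g0 a1 by simp
  next
    case (Suc L)
    have qM: "q a (Suc M) = a (Suc M) * q a M + q a L" using Suc by simp
    show ?thesis
    proof (cases "gam M = a (Suc M)")
      case False
      then have "Suc (gam M) * q a M \<le> a (Suc M) * q a M"
        using gle[of M] Suc by (intro mult_le_mono1) simp
      moreover have "(\<Sum>n\<le>L. gam n * q a n) < q a M" using less[of L] Suc by simp
      ultimately show ?thesis using qM Suc by simp
    next
      case True
      show ?thesis
      proof (cases L)
        case 0
        then show ?thesis using True qM Suc g0 q_pos[of L] by simp
      next
        case (Suc K)
        \<comment> \<open>A maximal top digit leaves room only for a remainder below
          \<open>q a L\<close>; the vanishing of the next digit ensures that.\<close>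
        then have "gam L = 0" using carry[of M] True \<open>M = Suc L\<close> by simp
        moreover have "(\<Sum>n\<le>K. gam n * q a n) < q a L" using less[of K] Suc \<open>M = Suc L\<close> by simp
        ultimately show ?thesis using qM True Suc \<open>M = Suc L\<close> by simp
      qed
    qed
  qed
qed

text \<open>The sum of the lower digits is a valid remainder by
  \<open>ostrowski_partial_less\<close>, so each higher digit is stripped by
  \<open>model_sign_rest\<close>.\<close>

lemma ostrowski_partial_sign:
  assumes os: "ostrowski a k gam" and m: "m \<ge> 1" "gam m > 0" "\<forall>n<m. gam n = 0" and "m \<le> M"
  shows "(\<Sum>n\<le>M. gam n * q a n) > 0 \<and>
    model_sign a (\<Sum>n\<le>M. gam n * q a n) = model_sign a (gam m * q a m)"
  using assms(5)
proof (induction M rule: dec_induct)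
  case base
  obtain l where l: "m = Suc l" using m(1) by (cases m) auto
  have "(\<Sum>n\<le>l. gam n * q a n) = 0" using m(3) l by simp
  then have "(\<Sum>n\<le>m. gam n * q a n) = gam m * q a m" using l by simp
  then show ?case using m(2) q_pos[of m] by simp
next
  case (step M)
  let ?S = "\<Sum>n\<le>M. gam n * q a n"
  have eq: "(\<Sum>n\<le>Suc M. gam n * q a n) = gam (Suc M) * q a (Suc M) + ?S" by simp
  have "model_sign a (gam (Suc M) * q a (Suc M) + ?S) = model_sign a ?S"
    using step ostrowski_partial_less[OF os, of M] ostrowski_partial_less[OF os, of "Suc M"] eq
    by (intro model_sign_rest) auto
  then show ?case using step unfolding eq by simp
qed

lemma ostrowski_sign:
  assumes os: "ostrowski a k gam" and m: "m \<ge> 1" "gam m > 0" "\<forall>n<m. gam n = 0"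
  shows "model_sign a k = model_sign a (gam m * q a m)"
proof -
  let ?T = "{n. gam n \<noteq> 0}"
  have fin: "finite ?T" and k: "k = (\<Sum>n\<in>?T. gam n * q a n)"
    using os by (auto simp: ostrowski_def)
  have "k = (\<Sum>n\<le>Max ?T. gam n * q a n)"
    unfolding k using fin by (intro sum.mono_neutral_left) auto
  moreover have "m \<le> Max ?T" using fin m(2) by simp
  ultimately show ?thesis using ostrowski_partial_sign[OF os m] by simp
qed

end

theorem theorem2p4:
  fixes f :: "real \<Rightarrow> real" and a :: "nat \<Rightarrow> nat"
  assumes digits_pos: "\<forall>n\<ge>1. a n \<ge> 1"
    and a123: "a 1 = 1" "a 2 = 1" "a 3 = 1"
    and unimodal: "unimodal f"
    and recurrent: "theta_recurrent f a"
  shows "(\<forall>n\<ge>1. (n mod 4 \<in> {0, 1} \<longrightarrow> (f ^^ q a n) 0 < 0) \<and>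
                 (n mod 4 \<notin> {0, 1} \<longrightarrow> (f ^^ q a n) 0 > 0))
       \<and> (\<forall>n\<ge>1. \<forall>g::nat. 1 < g \<and> g \<le> a (Suc n) \<longrightarrow>
                 (f ^^ q a n) 0 * (f ^^ (g * q a n)) 0 < 0)
       \<and> (\<forall>k>0. \<forall>gam m. ostrowski a k gam \<and> m \<ge> 1 \<and> gam m > 0 \<and>
                 (\<forall>n<m. gam n = 0) \<longrightarrow>
                 (f ^^ k) 0 * (f ^^ (gam m * q a m)) 0 > 0)"
proof -
  interpret unimodal_digits f a
    using assms by unfold_locales auto
  note sg = critical_orbit_sgn[OF recurrent]
  have sq: "sgn ((f ^^ q a n) 0) = ret_sign n" for n
    using sg[OF q_pos] model_sign_q by simp
  show ?thesis
  proof (intro conjI allI impI)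
    fix n :: nat
    show "(f ^^ q a n) 0 < 0" if "n mod 4 \<in> {0, 1}"
      using sq[of n] that by (simp add: ret_sign_def sgn_1_neg)
    show "(f ^^ q a n) 0 > 0" if "n mod 4 \<notin> {0, 1}"
      using sq[of n] that by (simp add: ret_sign_def sgn_1_pos)
  next
    fix n g :: nat
    assume n: "n \<ge> 1" and g: "1 < g \<and> g \<le> a (Suc n)"
    then have "sgn ((f ^^ (g * q a n)) 0) = - ret_sign n"
      using sg[of "g * q a n"] q_pos[of n] model_sign_mult_q[of n g] by simp
    then have "sgn ((f ^^ q a n) 0 * (f ^^ (g * q a n)) 0) = -1"
      using sq[of n] ret_sign_cases[of n] by (auto simp: sgn_mult)
    then show "(f ^^ q a n) 0 * (f ^^ (g * q a n)) 0 < 0" by (simp add: sgn_1_neg)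
  next
    fix k m :: nat and gam
    assume k: "k > 0"
      and o: "ostrowski a k gam \<and> m \<ge> 1 \<and> gam m > 0 \<and> (\<forall>n<m. gam n = 0)"
    have "sgn ((f ^^ k) 0) = sgn ((f ^^ (gam m * q a m)) 0)"
      using sg[OF k] sg[of "gam m * q a m"] ostrowski_sign[of k gam m] o q_pos[of m] by simp
    moreover have "sgn ((f ^^ k) 0) \<noteq> 0" using sg[OF k] model_sign_cases[of a k] by auto
    ultimately show "(f ^^ k) 0 * (f ^^ (gam m * q a m)) 0 > 0"
      by (auto simp: sgn_if zero_less_mult_iff split: if_splits)
  qed
qed

end
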